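(* Let $X$ and $Y$ be $\mathbb{R}$-linear spaces and let $f:X\to Y$ be a mapping such that $f(0_X)=0_Y$ and such that there are $a_0,a_1\in X$ for which $f(a_0)$ and $f(a_1)$ are linearly independent. Then $f$ is an $\mathbb{R}$-linear mapping if and only if $f$ satisfies both of the following conditions: (i) for every line $L\subseteq X$, the image $f[L]$ is either a point or a line in $Y$; and (ii) for every line $L\subseteq X$, if $f[L]$ is a line in $Y$, then the restriction $f\restriction L$ is injective.
   Context: An $\mathbb{R}$-linear space is a vector space over $\mathbb{R}$ (of arbitrary, possibly infinite, dimension). $0_X$ and $0_Y$ denote the zero vectors. A subset of a linear space is a point if it is a singleton (an affine subspace of dimension $0$). A line is an affine subspace of dimension $1$, i.e. a set of the form $\{rd+a : r\in\mathbb{R}\}$ with $d\neq 0$. For $U\subseteq X$, $f[U]=\{f(u):u\in U\}$. *)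

theory Defs
  imports Complex_Main
begin

definition is_line :: "'a::real_vector set \<Rightarrow> bool" where
  "is_line L \<longleftrightarrow> (\<exists>a d. d \<noteq> 0 \<and> L = {r *\<^sub>R d + a | r. True})"

(* Linear independence of the pair (v, w) as a family: the set {v, w} alone would
   also be independent when v = w and v is nonzero, hence the first conjunct. *)
definition lin_indep_pair :: "'a::real_vector \<Rightarrow> 'a \<Rightarrow> bool" where
  "lin_indep_pair v w \<longleftrightarrow> v \<noteq> w \<and> independent {v, w}"

end

theory Submission
  imports Defs
begin

text \<open>
  The forward direction is a direct computation with the parametrisation of a line.

  For the converse, the two conditions on lines amount to a single one: along every line \<open>f\<close> is
  an affine parametrisation up to a bijective change of the real parameter
  (\<open>preserves_lines\<close>); a line collapsed to a point is no exception, as then every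
  reparametrisation will do. It remains to see that the change of parameter is trivial and that
  \<open>f\<close> is additive.

  Suppose first that \<open>f x\<close> and \<open>f y\<close> are independent. A coincidence of values of \<open>f\<close> in the
  plane of \<open>x\<close> and \<open>y\<close> would collapse a whole line, and that line meets the sides of some
  triangle whose image is non-degenerate in points with different images. This makes \<open>f\<close> respect
  parallelism to both axes of the plane (\<open>image_of_axes_disjoint\<close>), so that
  \<open>f (s x + t y) = \<alpha> s f x + \<beta> t f y\<close> (\<open>plane_coordinates\<close>). Evaluating this on
  the diagonal, on lines through the origin, and on the line from \<open>x\<close> to \<open>y\<close> shows that
  \<open>\<alpha> = \<beta>\<close> is a ring endomorphism of the reals, hence the identity.

  Homogeneity at an arbitrary \<open>x\<close> with \<open>f x \<noteq> 0\<close> follows because some value of \<open>f\<close> is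
  independent of \<open>f x\<close>. Additivity at \<open>x, y\<close> with dependent images is obtained from the
  independent case with the help of a third vector whose image leaves the line of those images.
\<close>

section \<open>Independent pairs\<close>

lemma lin_indep_pair_iff:
  "lin_indep_pair v w \<longleftrightarrow> (\<forall>a b. a *\<^sub>R v + b *\<^sub>R w = 0 \<longrightarrow> a = 0 \<and> b = 0)"
proof
  assume L: "lin_indep_pair v w"
  then have w: "w \<noteq> 0" and v: "v \<notin> span {w}"
    by (auto simp: lin_indep_pair_def independent_insert)
  show "\<forall>a b. a *\<^sub>R v + b *\<^sub>R w = 0 \<longrightarrow> a = 0 \<and> b = 0"
  proof (intro allI impI)
    fix a b assume eq: "a *\<^sub>R v + b *\<^sub>R w = 0"
    have "a = 0"
    proof (rule ccontr)
      assume a: "a \<noteq> 0"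
      have "a *\<^sub>R v = (- b) *\<^sub>R w" using eq by (simp add: eq_neg_iff_add_eq_0)
      then have "(1 / a) *\<^sub>R (a *\<^sub>R v) = (1 / a) *\<^sub>R ((- b) *\<^sub>R w)" by simp
      then have "v = (- b / a) *\<^sub>R w" using a by simp
      then show False using v by (metis span_base span_scale singletonI)
    qed
    then show "a = 0 \<and> b = 0" using eq w by simp
  qed
next
  assume R: "\<forall>a b. a *\<^sub>R v + b *\<^sub>R w = 0 \<longrightarrow> a = 0 \<and> b = 0"
  have "v \<noteq> w" using R[rule_format, of 1 "-1"] by auto
  moreover have "w \<noteq> 0" using R[rule_format, of 0 1] by auto
  moreover have "v \<notin> span {w}"
  proof
    assume "v \<in> span {w}"
    then obtain k where "v = k *\<^sub>R w" by (auto simp: span_singleton)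
    then show False using R[rule_format, of 1 "- k"] by simp
  qed
  ultimately show "lin_indep_pair v w"
    by (auto simp: lin_indep_pair_def independent_insert)
qed

lemma lin_indep_pair_sym: "lin_indep_pair v w \<Longrightarrow> lin_indep_pair w v"
  by (auto simp: lin_indep_pair_def insert_commute)

lemma lin_indep_pair_nonzero:
  assumes "lin_indep_pair v w"
  shows "v \<noteq> 0" and "w \<noteq> 0"
proof -
  show "v \<noteq> 0"
    using assms[unfolded lin_indep_pair_iff, rule_format, of 1 0] by auto
  show "w \<noteq> 0"
    using assms[unfolded lin_indep_pair_iff, rule_format, of 0 1] by auto
qed

lemma lin_indep_pair_coeffs_eq:
  assumes "lin_indep_pair v w" and eq: "a *\<^sub>R v + b *\<^sub>R w = c *\<^sub>R v + d *\<^sub>R w"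
  shows "a = c \<and> b = d"
proof -
  have "(a - c) *\<^sub>R v + (b - d) *\<^sub>R w = (a *\<^sub>R v + b *\<^sub>R w) - (c *\<^sub>R v + d *\<^sub>R w)"
    by (simp add: algebra_simps)
  also have "\<dots> = 0" using eq by simp
  finally show ?thesis using assms(1) unfolding lin_indep_pair_iff by fastforce
qed

lemma lin_indep_pair_shear:
  assumes "lin_indep_pair v w" and k: "k \<noteq> 0"
  shows "lin_indep_pair (k *\<^sub>R v) (l *\<^sub>R v + w)"
  unfolding lin_indep_pair_iff
proof (intro allI impI)
  fix a b assume "a *\<^sub>R k *\<^sub>R v + b *\<^sub>R (l *\<^sub>R v + w) = 0"
  then have "(a * k + b * l) *\<^sub>R v + b *\<^sub>R w = 0" by (simp add: algebra_simps)
  then have "a * k + b * l = 0" "b = 0" using assms(1) unfolding lin_indep_pair_iff by blast+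
  then show "a = 0 \<and> b = 0" using k by simp
qed

lemma not_lin_indep_pair_multiple:
  assumes u: "u \<noteq> 0" and no: "\<not> lin_indep_pair u v"
  obtains k where "v = k *\<^sub>R u"
proof (cases "v = u")
  case True
  then show thesis using that[of 1] by simp
next
  case False
  then have "v \<in> span {u}"
    using no u unfolding lin_indep_pair_def
    by (simp add: insert_commute[of u v] independent_insert)
  then show thesis using that by (auto simp: span_singleton)
qed

lemma lin_indep_pair_complete:
  assumes "lin_indep_pair v w" and u: "u \<noteq> 0"
  shows "lin_indep_pair u v \<or> lin_indep_pair u w"
proof (rule ccontr)
  assume no: "\<not> ?thesis"
  obtain k l where k: "v = k *\<^sub>R u" and l: "w = l *\<^sub>R u"
    using no not_lin_indep_pair_multiple[OF u] by metis
  have "l *\<^sub>R v + (- k) *\<^sub>R w = 0" by (simp add: k l)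
  then have "k = 0" using assms(1) unfolding lin_indep_pair_iff by fastforce
  then show False using k lin_indep_pair_nonzero[OF assms(1)] by simp
qed

section \<open>Ring endomorphisms of the reals\<close>

text \<open>Squares go to squares, so such a map is monotone; it fixes the rationals, which are dense.\<close>

lemma real_ring_endomorphism_id:
  fixes g :: "real \<Rightarrow> real"
  assumes add: "\<And>a b. g (a + b) = g a + g b"
    and mult: "\<And>a b. g (a * b) = g a * g b"
    and one: "g 1 = 1"
  shows "g x = x"
proof -
  have zero: "g 0 = 0" using add[of 0 0] by simp
  have minus: "g (- a) = - g a" for a using add[of a "- a"] zero by simp
  have nat: "g (of_nat n) = of_nat n" for n
    by (induction n) (simp_all add: zero add one)
  have int: "g (of_int k) = of_int k" for k
    by (cases k rule: int_cases2) (simp_all add: nat minus)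
  have rat: "g q = q" if "q \<in> \<rat>" for q
  proof -
    obtain k l where q: "q = of_int k / of_int l" "l \<noteq> 0"
      using \<open>q \<in> \<rat>\<close> by (metis Rats_cases' less_irrefl)
    have "g q * of_int l = of_int k"
      using mult[of q "of_int l"] q by (simp add: int)
    moreover have "q * of_int l = of_int k" using q by simp
    ultimately show ?thesis using q(2) by (metis mult_right_cancel of_int_eq_0_iff)
  qed
  have mono: "g a \<le> g b" if "a \<le> b" for a b
  proof -
    have "g b - g a = g (sqrt (b - a) * sqrt (b - a))"
      using add[of b "- a"] minus that by simp
    also have "\<dots> \<ge> 0" by (simp only: mult zero_le_square)
    finally show ?thesis by simp
  qed
  show ?thesis
  proof (rule ccontr)
    assume "g x \<noteq> x"
    then consider "g x < x" | "x < g x" by linarith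
    then show False
    proof cases
      case 1
      then obtain q where "q \<in> \<rat>" "g x < q" "q < x" using Rats_dense_in_real by blast
      then show False using mono[of q x] rat by fastforce
    next
      case 2
      then obtain q where "q \<in> \<rat>" "x < q" "q < g x" using Rats_dense_in_real by blast
      then show False using mono[of x q] rat by fastforce
    qed
  qed
qed

section \<open>Maps that are reparametrisations along lines\<close>

text \<open>Both conditions of the theorem in one formula without sets: injectivity of \<open>\<gamma>\<close> says that a line
  not collapsed is mapped injectively, surjectivity that its image is a full line. If
  \<open>f x = f y\<close>, the formula says that the line is collapsed, whatever \<open>\<gamma>\<close> is.\<close>

definition preserves_lines :: "('a::real_vector \<Rightarrow> 'b::real_vector) \<Rightarrow> bool" where
  "preserves_lines f \<longleftrightarrow>
    (\<forall>x y. \<exists>\<gamma>. bij \<gamma> \<and> (\<forall>r. f (x + r *\<^sub>R (y - x)) = f x + \<gamma> r *\<^sub>R (f y - f x)))"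

lemma is_lineI: "d \<noteq> 0 \<Longrightarrow> is_line (range (\<lambda>r. a + r *\<^sub>R d))"
  unfolding is_line_def by (force simp: add.commute)

lemma is_lineE:
  assumes "is_line L"
  obtains a d where "d \<noteq> 0" "L = range (\<lambda>r. a + r *\<^sub>R d)"
  using assms unfolding is_line_def by (force simp: add.commute)

lemma range_line_through_point:
  fixes p :: "'a::real_vector"
  assumes "p \<in> range (\<lambda>r. a + r *\<^sub>R d)"
  shows "range (\<lambda>r. a + r *\<^sub>R d) = range (\<lambda>r. p + r *\<^sub>R d)"
proof -
  obtain k where k: "p = a + k *\<^sub>R d" using assms by auto
  have "a + r *\<^sub>R d = p + (r - k) *\<^sub>R d" "p + r *\<^sub>R d = a + (r + k) *\<^sub>R d" for r
    by (simp_all add: k algebra_simps)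
  then show ?thesis by blast
qed

lemma line_through_two_points:
  assumes "is_line L" and "p \<in> L" "q \<in> L" "p \<noteq> q"
  shows "L = range (\<lambda>r. p + r *\<^sub>R (q - p))"
proof -
  obtain a d where d: "d \<noteq> 0" and "L = range (\<lambda>r. a + r *\<^sub>R d)"
    using is_lineE[OF assms(1)] .
  then have L: "L = range (\<lambda>r. p + r *\<^sub>R d)"
    using range_line_through_point assms(2) by metis
  then obtain k where k: "q = p + k *\<^sub>R d" using assms(3) by auto
  then have k0: "k \<noteq> 0" using assms(4) by auto
  have "p + r *\<^sub>R d = p + (r / k) *\<^sub>R (q - p)" "p + r *\<^sub>R (q - p) = p + (r * k) *\<^sub>R d" for r
    using k k0 by simp_all
  then show ?thesis unfolding L by blast
qed

lemma is_line_not_singleton: "is_line L \<Longrightarrow> \<not> is_singleton L"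
proof
  assume "is_line L" "is_singleton L"
  then obtain a d p where d: "d \<noteq> 0" and L: "L = range (\<lambda>r. a + r *\<^sub>R d)" "L = {p}"
    by (metis is_lineE is_singletonE)
  have "a + 0 *\<^sub>R d \<in> L" "a + 1 *\<^sub>R d \<in> L" using L(1) by blast+
  then show False using L(2) d by simp
qed

lemma preserves_linesI:
  fixes f :: "'a::real_vector \<Rightarrow> 'b::real_vector"
  assumes image: "\<And>L. is_line L \<Longrightarrow> is_singleton (f ` L) \<or> is_line (f ` L)"
    and inj: "\<And>L. is_line L \<Longrightarrow> is_line (f ` L) \<Longrightarrow> inj_on f L"
  shows "preserves_lines f"
  unfolding preserves_lines_def
proof (intro allI)
  fix x y :: 'a
  let ?p = "\<lambda>r. x + r *\<^sub>R (y - x)"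
  have const: "\<exists>\<gamma>. bij \<gamma> \<and> (\<forall>r. f (?p r) = f x + \<gamma> r *\<^sub>R (f y - f x))"
    if "\<And>r. f (?p r) = f x" "f y = f x"
    using that by (intro exI[of _ id]) simp
  show "\<exists>\<gamma>. bij \<gamma> \<and> (\<forall>r. f (?p r) = f x + \<gamma> r *\<^sub>R (f y - f x))"
  proof (cases "x = y")
    case True
    then show ?thesis by (intro const) simp_all
  next
    case False
    let ?L = "range ?p"
    have L: "is_line ?L" using False by (intro is_lineI) simp
    have ends: "?p 0 = x" "?p 1 = y" by simp_all
    have x: "x \<in> ?L" and y: "y \<in> ?L" using ends by (metis rangeI)+
    show ?thesis
    proof (cases "is_line (f ` ?L)")
      case True
      have inj_L: "inj_on f ?L" using inj[OF L True] .
      then have fxy: "f x \<noteq> f y" using False x y by (auto dest: inj_onD)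
      then have range: "f ` ?L = range (\<lambda>r. f x + r *\<^sub>R (f y - f x))"
        using line_through_two_points[OF True] x y by blast
      then have "\<forall>r. \<exists>c. f (?p r) = f x + c *\<^sub>R (f y - f x)" by blast
      then obtain \<gamma> where g: "\<And>r. f (?p r) = f x + \<gamma> r *\<^sub>R (f y - f x)" by metis
      have "inj \<gamma>"
      proof (rule injI)
        fix r s assume "\<gamma> r = \<gamma> s"
        then have "f (?p r) = f (?p s)" by (simp add: g)
        then have "?p r = ?p s" using inj_L by (auto dest: inj_onD)
        then show "r = s" using False by simp
      qed
      moreover have "surj \<gamma>"
        unfolding surj_def
      proof
        fix c
        have "f x + c *\<^sub>R (f y - f x) \<in> f ` ?L" unfolding range by blast
        then obtain r where "f x + c *\<^sub>R (f y - f x) = f (?p r)" by blast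
        then have "c = \<gamma> r" using fxy by (simp add: g)
        then show "\<exists>r. c = \<gamma> r" by blast
      qed
      ultimately show ?thesis using g by (auto simp: bij_def)
    next
      case False
      then obtain p where "f ` ?L = {p}" using image[OF L] by (metis is_singletonE)
      then have p: "f z = p" if "z \<in> ?L" for z using that by blast
      show ?thesis by (intro const) (simp_all add: p[OF x] p[OF y] p[OF rangeI])
    qed
  qed
qed

lemma preserves_lines_collapse:
  assumes "preserves_lines f" and "f x = f y"
  shows "f (x + r *\<^sub>R (y - x)) = f x"
proof -
  obtain \<gamma> where "f (x + r *\<^sub>R (y - x)) = f x + \<gamma> r *\<^sub>R (f y - f x)"
    using assms(1) unfolding preserves_lines_def by metis
  then show ?thesis using assms(2) by simp
qed

lemma preserves_lines_axis:
  assumes "preserves_lines f" and "f 0 = 0" and "f x \<noteq> 0"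
  obtains \<alpha> where "bij \<alpha>" "\<alpha> 0 = 0" "\<alpha> 1 = 1" "\<And>r. f (r *\<^sub>R x) = \<alpha> r *\<^sub>R f x"
proof -
  obtain \<alpha> where b: "bij \<alpha>" and a: "\<And>r. f (0 + r *\<^sub>R (x - 0)) = f 0 + \<alpha> r *\<^sub>R (f x - f 0)"
    using assms(1) unfolding preserves_lines_def by meson
  then have a: "f (r *\<^sub>R x) = \<alpha> r *\<^sub>R f x" for r using a[of r] assms(2) by simp
  show thesis
  proof (rule that[of \<alpha>])
    show "\<alpha> 0 = 0" using a[of 0] assms by simp
    have "(\<alpha> 1 - 1) *\<^sub>R f x = 0" using a[of 1] by (simp add: algebra_simps)
    then show "\<alpha> 1 = 1" using assms(3) by simp
  qed (use a b in auto)
qed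

text \<open>The form in which a third side is used below, for triangles with one vertex at the origin and
  one on the axis of each of \<open>x\<close> and \<open>y\<close>: how \<open>r\<close> moves the parameter \<open>c\<close> never matters, only
  that the image lies on the line through the images of the two vertices.\<close>

lemma preserves_lines_transversal:
  assumes "preserves_lines f" and "f (s *\<^sub>R x) = a *\<^sub>R u" and "f (t *\<^sub>R y) = b *\<^sub>R v"
  shows "\<exists>c. f (((1 - r) * s) *\<^sub>R x + (r * t) *\<^sub>R y) = ((1 - c) * a) *\<^sub>R u + (c * b) *\<^sub>R v"
proof -
  obtain \<gamma> where
    "f (s *\<^sub>R x + r *\<^sub>R (t *\<^sub>R y - s *\<^sub>R x)) = a *\<^sub>R u + \<gamma> r *\<^sub>R (b *\<^sub>R v - a *\<^sub>R u)"
    using assms unfolding preserves_lines_def by metis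
  then show ?thesis by (intro exI[of _ "\<gamma> r"]) (simp add: algebra_simps)
qed

section \<open>A plane whose axes have independent images\<close>

text \<open>A zero off the axis of \<open>y\<close> collapses its line through the origin. That line meets the line
  through \<open>x\<close> and \<open>c y\<close> for \<open>c = 1\<close> or \<open>c = 2\<close>, since it cannot be parallel to both. But the
  images of both these lines avoid the origin.\<close>

lemma no_zero_off_axis:
  assumes P: "preserves_lines f" and f0: "f 0 = 0" and ind: "lin_indep_pair (f x) (f y)"
    and s: "s \<noteq> 0"
  shows "f (s *\<^sub>R x + t *\<^sub>R y) \<noteq> 0"
proof
  assume z: "f (s *\<^sub>R x + t *\<^sub>R y) = 0"
  obtain \<beta> where b: "bij \<beta>" "\<beta> 0 = 0" and fb: "\<And>r. f (r *\<^sub>R y) = \<beta> r *\<^sub>R f y"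
    using preserves_lines_axis[OF P f0 lin_indep_pair_nonzero(2)[OF ind]] by metis
  obtain c :: real where c: "c \<noteq> 0" "c * s + t \<noteq> 0"
  proof (cases "s + t = 0")
    case True
    then have "2 * s + t \<noteq> 0" using s by linarith
    then show thesis using that[of 2] by simp
  qed (use that[of 1] in simp)
  define k where "k = c / (c * s + t)"
  define q where "q = t / (c * s + t)"
  have ks: "k * s = (1 - q) * 1" and kt: "k * t = q * c"
    using c by (simp_all add: k_def q_def field_simps)
  have "f (0 + k *\<^sub>R ((s *\<^sub>R x + t *\<^sub>R y) - 0)) = f 0"
    using preserves_lines_collapse[OF P] z f0 by metis
  then have "f ((k * s) *\<^sub>R x + (k * t) *\<^sub>R y) = 0"
    using f0 by (simp add: algebra_simps)
  moreover have "f (1 *\<^sub>R x) = 1 *\<^sub>R f x" by simp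
  ultimately obtain e where "((1 - e) * 1) *\<^sub>R f x + (e * \<beta> c) *\<^sub>R f y = 0"
    using preserves_lines_transversal[OF P _ fb[of c], of 1 x 1 "f x" q] ks kt by metis
  then have "(1 - e) * 1 = 0" "e * \<beta> c = 0"
    using ind unfolding lin_indep_pair_iff by blast+
  then have "\<beta> c = \<beta> 0" using b by simp
  then show False using b(1) c(1) by (metis bij_pointE)
qed

text \<open>A common value collapses a line. Unless that line is parallel to \<open>x\<close>, it meets the axes
  of both \<open>x\<close> and \<open>y\<close>, so its image is the origin, which is excluded by
  \<open>no_zero_off_axis\<close>. If it is parallel to \<open>x\<close>, it passes
  through the midpoint of \<open>x\<close> and \<open>2 t y\<close>, whose image lies on the axis of \<open>f y\<close> only at
  \<open>f (2 t y)\<close>.\<close>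

lemma image_of_axes_disjoint:
  assumes P: "preserves_lines f" and f0: "f 0 = 0" and ind: "lin_indep_pair (f x) (f y)"
    and s: "s \<noteq> 0"
  shows "f (s *\<^sub>R x + r *\<^sub>R y) \<noteq> f (t *\<^sub>R y)"
proof
  assume eq: "f (s *\<^sub>R x + r *\<^sub>R y) = f (t *\<^sub>R y)"
  obtain \<alpha> where fa: "\<And>r. f (r *\<^sub>R x) = \<alpha> r *\<^sub>R f x"
    using preserves_lines_axis[OF P f0 lin_indep_pair_nonzero(1)[OF ind]] by metis
  obtain \<beta> where b: "bij \<beta>" "\<beta> 0 = 0" and fb: "\<And>r. f (r *\<^sub>R y) = \<beta> r *\<^sub>R f y"
    using preserves_lines_axis[OF P f0 lin_indep_pair_nonzero(2)[OF ind]] by metis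
  have coll: "f ((q * s) *\<^sub>R x + (t + q * (r - t)) *\<^sub>R y) = \<beta> t *\<^sub>R f y" for q
  proof -
    have "f (t *\<^sub>R y + q *\<^sub>R ((s *\<^sub>R x + r *\<^sub>R y) - t *\<^sub>R y)) = f (t *\<^sub>R y)"
      using preserves_lines_collapse[OF P] eq by metis
    then show ?thesis by (simp add: fb algebra_simps)
  qed
  have t0: "t \<noteq> 0"
    using no_zero_off_axis[OF P f0 ind s, of r] eq f0 by auto
  show False
  proof (cases "r = t")
    case False
    define q where "q = t / (t - r)"
    have "t + q * (r - t) = 0" using False by (simp add: q_def field_simps)
    then have "\<alpha> (q * s) *\<^sub>R f x = \<beta> t *\<^sub>R f y" using coll[of q] by (simp add: fa)
    then have "\<alpha> (q * s) *\<^sub>R f x + (- \<beta> t) *\<^sub>R f y = 0" by simp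
    then have "\<beta> t = \<beta> 0" using ind b(2) unfolding lin_indep_pair_iff by fastforce
    then show False using b(1) t0 by (metis bij_pointE)
  next
    case True
    have "f ((1 / 2) *\<^sub>R x + t *\<^sub>R y) = \<beta> t *\<^sub>R f y"
      using coll[of "1 / (2 * s)"] s True by simp
    moreover have "f (1 *\<^sub>R x) = 1 *\<^sub>R f x" by simp
    ultimately obtain e where
      "((1 - e) * 1) *\<^sub>R f x + (e * \<beta> (2 * t)) *\<^sub>R f y = 0 *\<^sub>R f x + \<beta> t *\<^sub>R f y"
      using preserves_lines_transversal[OF P _ fb[of "2 * t"], of 1 x 1 "f x" "1 / 2"] by auto
    from lin_indep_pair_coeffs_eq[OF ind this] have "\<beta> (2 * t) = \<beta> t" by auto
    then have "2 * t = t" using b(1) by (metis bij_pointE)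
    then show False using t0 by simp
  qed
qed

text \<open>The image of a parallel to the axis of \<open>y\<close>, other than the axis itself, stays in the plane of
  \<open>f x\<close> and \<open>f y\<close> and misses the axis of \<open>f y\<close>, hence it is a point or parallel to that axis.\<close>

lemma parallel_preserved:
  assumes P: "preserves_lines f" and f0: "f 0 = 0" and ind: "lin_indep_pair (f x) (f y)"
    and fs: "f (s *\<^sub>R x) = a *\<^sub>R f x"
  shows "\<exists>b. f (s *\<^sub>R x + t *\<^sub>R y) = a *\<^sub>R f x + b *\<^sub>R f y"
proof -
  obtain \<alpha> where fa: "\<And>r. f (r *\<^sub>R x) = \<alpha> r *\<^sub>R f x"
    using preserves_lines_axis[OF P f0 lin_indep_pair_nonzero(1)[OF ind]] by metis
  obtain \<beta> where b: "bij \<beta>" and fb: "\<And>r. f (r *\<^sub>R y) = \<beta> r *\<^sub>R f y"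
    using preserves_lines_axis[OF P f0 lin_indep_pair_nonzero(2)[OF ind]] by metis
  show ?thesis
  proof (cases "s = 0")
    case True
    then have "a = 0" using fs f0 lin_indep_pair_nonzero(1)[OF ind] by simp
    then show ?thesis using True fb by auto
  next
    case False
    \<comment> \<open>As a midpoint of points on the axes, \<open>s x + y\<close> is mapped into the plane.\<close>
    have "((1 - 1 / 2) * (2 * s)) *\<^sub>R x + (1 / 2 * 2) *\<^sub>R y = s *\<^sub>R x + y" by simp
    then obtain c d where cd: "f (s *\<^sub>R x + y) = c *\<^sub>R f x + d *\<^sub>R f y"
      using preserves_lines_transversal[OF P fa[of "2 * s"] fb[of 2], of "1 / 2"] by metis
    obtain \<gamma> where g: "bij \<gamma>" and
      "\<And>r. f (s *\<^sub>R x + r *\<^sub>R ((s *\<^sub>R x + y) - s *\<^sub>R x))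
         = f (s *\<^sub>R x) + \<gamma> r *\<^sub>R (f (s *\<^sub>R x + y) - f (s *\<^sub>R x))"
      using P unfolding preserves_lines_def by meson
    then have fg: "f (s *\<^sub>R x + r *\<^sub>R y)
        = (a + \<gamma> r * (c - a)) *\<^sub>R f x + (\<gamma> r * d) *\<^sub>R f y" for r
      by (simp only: add_diff_cancel_left' fs cd) (simp add: algebra_simps)
    have "c = a"
    proof (rule ccontr)
      assume "c \<noteq> a"
      \<comment> \<open>The parameter at which the image line crosses the axis of \<open>f y\<close>.\<close>
      obtain r where "\<gamma> r = a / (a - c)" using g by (metis bij_pointE)
      then have "a + \<gamma> r * (c - a) = 0" using \<open>c \<noteq> a\<close> by (simp add: field_simps)
      moreover obtain t' where "\<beta> t' = \<gamma> r * d" using b by (metis bij_pointE)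
      ultimately have "f (s *\<^sub>R x + r *\<^sub>R y) = f (t' *\<^sub>R y)" by (simp add: fg fb)
      then show False using image_of_axes_disjoint[OF P f0 ind False] by blast
    qed
    then show ?thesis using fg by auto
  qed
qed

lemma plane_coordinates:
  assumes P: "preserves_lines f" and f0: "f 0 = 0" and ind: "lin_indep_pair (f x) (f y)"
    and fa: "\<And>r. f (r *\<^sub>R x) = \<alpha> r *\<^sub>R f x" and fb: "\<And>r. f (r *\<^sub>R y) = \<beta> r *\<^sub>R f y"
  shows "f (s *\<^sub>R x + t *\<^sub>R y) = \<alpha> s *\<^sub>R f x + \<beta> t *\<^sub>R f y"
proof -
  obtain b where b: "f (s *\<^sub>R x + t *\<^sub>R y) = \<alpha> s *\<^sub>R f x + b *\<^sub>R f y"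
    using parallel_preserved[OF P f0 ind fa] by blast
  obtain a where "f (t *\<^sub>R y + s *\<^sub>R x) = \<beta> t *\<^sub>R f y + a *\<^sub>R f x"
    using parallel_preserved[OF P f0 lin_indep_pair_sym[OF ind] fb] by blast
  then have "\<alpha> s *\<^sub>R f x + b *\<^sub>R f y = a *\<^sub>R f x + \<beta> t *\<^sub>R f y"
    using b by (simp add: add.commute)
  from lin_indep_pair_coeffs_eq[OF ind this] show ?thesis using b by simp
qed

text \<open>On the line from the origin to \<open>s x + y\<close> the two coordinates are reparametrised alike,
  which gives \<open>\<alpha> = \<beta>\<close> for \<open>s = 1\<close> and multiplicativity in general. The line from \<open>x\<close> to \<open>y\<close>
  gives \<open>\<alpha> (1 - r) = 1 - \<alpha> r\<close>, and multiplicativity spreads this to additivity.\<close>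

lemma linear_on_plane:
  assumes P: "preserves_lines f" and f0: "f 0 = 0" and ind: "lin_indep_pair (f x) (f y)"
  shows "f (s *\<^sub>R x + t *\<^sub>R y) = s *\<^sub>R f x + t *\<^sub>R f y"
proof -
  obtain \<alpha> where a: "bij \<alpha>" "\<alpha> 0 = 0" "\<alpha> 1 = 1" and fa: "\<And>r. f (r *\<^sub>R x) = \<alpha> r *\<^sub>R f x"
    using preserves_lines_axis[OF P f0 lin_indep_pair_nonzero(1)[OF ind]] by metis
  obtain \<beta> where b: "bij \<beta>" "\<beta> 0 = 0" "\<beta> 1 = 1" and fb: "\<And>r. f (r *\<^sub>R y) = \<beta> r *\<^sub>R f y"
    using preserves_lines_axis[OF P f0 lin_indep_pair_nonzero(2)[OF ind]] by metis
  note coords = plane_coordinates[OF P f0 ind fa fb]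
  have radial: "\<alpha> (r * s) = \<beta> r * \<alpha> s" for r s
  proof -
    obtain \<gamma> where "f (0 + r *\<^sub>R ((s *\<^sub>R x + 1 *\<^sub>R y) - 0))
        = f 0 + \<gamma> r *\<^sub>R (f (s *\<^sub>R x + 1 *\<^sub>R y) - f 0)"
      using P unfolding preserves_lines_def by metis
    also have "0 + r *\<^sub>R ((s *\<^sub>R x + 1 *\<^sub>R y) - 0) = (r * s) *\<^sub>R x + r *\<^sub>R y"
      by (simp add: algebra_simps)
    finally have "\<alpha> (r * s) *\<^sub>R f x + \<beta> r *\<^sub>R f y = (\<gamma> r * \<alpha> s) *\<^sub>R f x + \<gamma> r *\<^sub>R f y"
      unfolding coords f0 by (simp add: b algebra_simps)
    from lin_indep_pair_coeffs_eq[OF ind this] show ?thesis by simp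
  qed
  have ab: "\<beta> r = \<alpha> r" for r using radial[of r 1] a by simp
  have mult: "\<alpha> (r * s) = \<alpha> r * \<alpha> s" for r s using radial ab by simp
  have compl: "\<alpha> (1 - r) + \<alpha> r = 1" for r
  proof -
    obtain c where
      "f (((1 - r) * 1) *\<^sub>R x + (r * 1) *\<^sub>R y) = ((1 - c) * 1) *\<^sub>R f x + (c * 1) *\<^sub>R f y"
      using preserves_lines_transversal[OF P, of 1 x 1 "f x" 1 y 1 "f y" r] by auto
    then have "\<alpha> (1 - r) *\<^sub>R f x + \<beta> r *\<^sub>R f y = (1 - c) *\<^sub>R f x + c *\<^sub>R f y"
      by (simp add: coords)
    from lin_indep_pair_coeffs_eq[OF ind this] show ?thesis using ab by simp
  qed
  have add: "\<alpha> (p + q) = \<alpha> p + \<alpha> q" for p q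
  proof (cases "p + q = 0")
    case True
    \<comment> \<open>Here the division by \<open>p + q\<close> of the other case is impossible, but \<open>\<alpha> (- 1)\<close> is a
      square root of 1 different from \<open>\<alpha> 1\<close>.\<close>
    have "\<alpha> (- 1) * \<alpha> (- 1) = 1" using mult[of "- 1" "- 1"] a by simp
    moreover have "\<alpha> (- 1) \<noteq> \<alpha> 1" using a(1) by (auto simp: bij_def dest: injD)
    ultimately have "\<alpha> (- 1) = - 1" using a(3) by (metis square_eq_1_iff)
    moreover have "q = - 1 * p" using True by simp
    ultimately have "\<alpha> q = - \<alpha> p" using mult[of "- 1" p] by simp
    then show ?thesis using True a by simp
  next
    case False
    have "1 - p / (p + q) = q / (p + q)" using False by (simp add: field_simps)
    then have "\<alpha> (q / (p + q)) + \<alpha> (p / (p + q)) = 1" using compl[of "p / (p + q)"] by simp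
    then have "\<alpha> (p + q) * \<alpha> (q / (p + q)) + \<alpha> (p + q) * \<alpha> (p / (p + q)) = \<alpha> (p + q)"
      by (metis distrib_left mult.right_neutral)
    then show ?thesis using False by (simp flip: mult)
  qed
  have "\<alpha> r = r" for r using real_ring_endomorphism_id[OF add mult a(3)] .
  then show ?thesis using coords ab by simp
qed

section \<open>Linearity on the whole space\<close>

lemma homogeneous:
  assumes P: "preserves_lines f" and f0: "f 0 = 0" and ex: "lin_indep_pair (f a0) (f a1)"
  shows "f (r *\<^sub>R x) = r *\<^sub>R f x"
proof (cases "f x = 0")
  case True
  then show ?thesis using preserves_lines_collapse[OF P, of 0 x r] f0 by simp
next
  case False
  then obtain z where "lin_indep_pair (f x) (f z)"
    using lin_indep_pair_complete[OF ex False] by blast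
  then show ?thesis using linear_on_plane[OF P f0, of x z r 0] by simp
qed

text \<open>The midpoint of \<open>x\<close> and \<open>y\<close> is mapped to the line through \<open>f x\<close> and \<open>f y\<close>, and by
  homogeneity it may be doubled.\<close>

lemma sum_in_span_of_images:
  assumes P: "preserves_lines f" and f0: "f 0 = 0" and ex: "lin_indep_pair (f a0) (f a1)"
  shows "\<exists>c d. f (x + y) = c *\<^sub>R f x + d *\<^sub>R f y"
proof -
  obtain c where "f ((1 / 2) *\<^sub>R x + (1 / 2) *\<^sub>R y) = (1 - c) *\<^sub>R f x + c *\<^sub>R f y"
    using preserves_lines_transversal[OF P, of 1 x 1 "f x" 1 y 1 "f y" "1 / 2"] by auto
  moreover have "f (x + y) = 2 *\<^sub>R f ((1 / 2) *\<^sub>R x + (1 / 2) *\<^sub>R y)"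
    using homogeneous[OF P f0 ex, of 2 "(1 / 2) *\<^sub>R x + (1 / 2) *\<^sub>R y"]
    by (simp add: scaleR_add_right)
  ultimately show ?thesis
    by (intro exI[of _ "2 * (1 - c)"] exI[of _ "2 * c"]) (simp add: scaleR_add_right)
qed

text \<open>A kernel vector \<open>x\<close> multiplies the value at \<open>y\<close> by some \<open>c\<close>. If \<open>c = 0\<close>, then the whole
  line from \<open>x\<close> in direction \<open>y\<close> lies in the kernel, hence also
  \<open>2 y = (x + 2 y) - x\<close>. Otherwise compare the values at
  \<open>(x + y) + z\<close> and \<open>x + (y + z)\<close>, where \<open>f z\<close> is independent of \<open>f y\<close>.\<close>

lemma translate_by_kernel:
  assumes P: "preserves_lines f" and f0: "f 0 = 0" and ex: "lin_indep_pair (f a0) (f a1)"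
    and x: "f x = 0" and y: "f y \<noteq> 0"
  shows "f (x + y) = f y"
proof -
  obtain z where ind: "lin_indep_pair (f y) (f z)"
    using lin_indep_pair_complete[OF ex y] by blast
  have multiple: "\<exists>c. f (x + w) = c *\<^sub>R f w" for w
    using sum_in_span_of_images[OF P f0 ex, of x w] x by auto
  obtain c where c: "f (x + y) = c *\<^sub>R f y" using multiple by blast
  obtain e where e: "f (x + (y + z)) = e *\<^sub>R f (y + z)" using multiple by blast
  have "c \<noteq> 0"
  proof
    assume "c = 0"
    then have "f (x + 2 *\<^sub>R ((x + y) - x)) = f x"
      using preserves_lines_collapse[OF P, of x "x + y" 2] x c by simp
    then have "f (x + 2 *\<^sub>R y) = 0" "f (- x) = 0"
      using x homogeneous[OF P f0 ex, of "- 1" x] by simp_all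
    then have "f ((x + 2 *\<^sub>R y) + - x) = 0"
      using sum_in_span_of_images[OF P f0 ex, of "x + 2 *\<^sub>R y" "- x"] by auto
    then show False using y homogeneous[OF P f0 ex, of 2 y] by simp
  qed
  have "lin_indep_pair (f (x + y)) (f z)"
    using lin_indep_pair_shear[OF ind \<open>c \<noteq> 0\<close>, of 0] c by simp
  then have "f ((x + y) + z) = c *\<^sub>R f y + 1 *\<^sub>R f z"
    using linear_on_plane[OF P f0, of "x + y" z 1 1] c by simp
  moreover have "f (x + (y + z)) = e *\<^sub>R f y + e *\<^sub>R f z"
    using linear_on_plane[OF P f0 ind, of 1 1] e by (simp add: scaleR_add_right)
  ultimately have "c *\<^sub>R f y + 1 *\<^sub>R f z = e *\<^sub>R f y + e *\<^sub>R f z"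
    by (simp add: add.assoc)
  from lin_indep_pair_coeffs_eq[OF ind this] show ?thesis using c by simp
qed

text \<open>If one of \<open>x\<close>, \<open>y\<close> and \<open>x + y\<close> is in the kernel, this is a translation by a kernel
  vector. If all images are non-zero multiples of \<open>f x\<close>, a vector \<open>z\<close> with image independent of
  \<open>f x\<close> is independent in image of all three, and the independent case applies to sums with
  \<open>z\<close>.\<close>

lemma additive:
  assumes P: "preserves_lines f" and f0: "f 0 = 0" and ex: "lin_indep_pair (f a0) (f a1)"
  shows "f (x + y) = f x + f y"
proof -
  note minus = homogeneous[OF P f0 ex, of "- 1", simplified]
  consider "f x = 0" "f y = 0" | "f x = 0" "f y \<noteq> 0" | "f x \<noteq> 0" "f y = 0"
    | "f x \<noteq> 0" "f (x + y) = 0" | "f x \<noteq> 0" "f y \<noteq> 0" "f (x + y) \<noteq> 0"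
    by blast
  then show ?thesis
  proof cases
    case 1
    then show ?thesis using sum_in_span_of_images[OF P f0 ex, of x y] by auto
  next
    case 2
    then show ?thesis using translate_by_kernel[OF P f0 ex] by simp
  next
    case 3
    then show ?thesis using translate_by_kernel[OF P f0 ex, of y x] by (simp add: add.commute)
  next
    case 4
    \<comment> \<open>Here \<open>y\<close> is the translate of \<open>- x\<close> by the kernel vector \<open>x + y\<close>.\<close>
    then show ?thesis using translate_by_kernel[OF P f0 ex, of "x + y" "- x"] by (simp add: minus)
  next
    case 5
    show ?thesis
    proof (cases "lin_indep_pair (f x) (f y)")
      case True
      then show ?thesis using linear_on_plane[OF P f0, of x y 1 1] by simp
    next
      case False
      obtain z where ind: "lin_indep_pair (f x) (f z)"
        using lin_indep_pair_complete[OF ex 5(1)] by blast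
      obtain k where k: "f y = k *\<^sub>R f x"
        using not_lin_indep_pair_multiple[OF 5(1) False] .
      obtain c d where "f (x + y) = c *\<^sub>R f x + d *\<^sub>R f y"
        using sum_in_span_of_images[OF P f0 ex] by blast
      then have l: "f (x + y) = (c + d * k) *\<^sub>R f x" by (simp add: k algebra_simps)
      have xz: "f (x + z) = f x + f z"
        using linear_on_plane[OF P f0 ind, of 1 1] by simp
      \<comment> \<open>Both ways of grouping \<open>x + y + z\<close> add vectors with independent images.\<close>
      have "k \<noteq> 0" using k 5 by auto
      then have "lin_indep_pair (f y) (f (x + z))"
        using lin_indep_pair_shear[OF ind, of k 1] k xz by simp
      then have 1: "f (y + (x + z)) = f y + (f x + f z)"
        using linear_on_plane[OF P f0, of y "x + z" 1 1] xz by simp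
      have "c + d * k \<noteq> 0" using l 5 by auto
      then have "lin_indep_pair (f (x + y)) (f z)"
        using lin_indep_pair_shear[OF ind, of "c + d * k" 0] l by simp
      then have "f ((x + y) + z) = f (x + y) + f z"
        using linear_on_plane[OF P f0, of "x + y" z 1 1] by simp
      moreover have "y + (x + z) = (x + y) + z" by (simp add: algebra_simps)
      ultimately show ?thesis using 1 by (simp add: algebra_simps)
    qed
  qed
qed

section \<open>The characterisation\<close>

lemma linear_image_line:
  assumes "linear f"
  shows "f ` range (\<lambda>r. a + r *\<^sub>R d) = range (\<lambda>r. f a + r *\<^sub>R f d)"
  by (simp add: image_image linear_add[OF assms] linear_scale[OF assms])

theorem theorem4p1:
  fixes f :: "'a::real_vector \<Rightarrow> 'b::real_vector"
  assumes "f 0 = 0"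
    and "\<exists>a0 a1. lin_indep_pair (f a0) (f a1)"
  shows "linear f \<longleftrightarrow>
    (\<forall>L. is_line L \<longrightarrow> is_singleton (f ` L) \<or> is_line (f ` L)) \<and>
    (\<forall>L. is_line L \<longrightarrow> is_line (f ` L) \<longrightarrow> inj_on f L)"
proof
  assume lin: "linear f"
  have "(is_singleton (f ` L) \<or> is_line (f ` L)) \<and> (is_line (f ` L) \<longrightarrow> inj_on f L)"
    if line: "is_line L" for L
  proof -
    obtain a d where L: "L = range (\<lambda>r. a + r *\<^sub>R d)"
      using line by (blast elim: is_lineE)
    show ?thesis
    proof (cases "f d = 0")
      case True
      then have "is_singleton (f ` L)"
        unfolding L linear_image_line[OF lin] by (simp add: is_singleton_def)
      then show ?thesis using is_line_not_singleton by blast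
    next
      case False
      have "is_line (f ` L)"
        unfolding L linear_image_line[OF lin] using False by (rule is_lineI)
      moreover have "inj_on f L"
        unfolding L using False
        by (auto simp: inj_on_def linear_add[OF lin] linear_scale[OF lin])
      ultimately show ?thesis by blast
    qed
  qed
  then show "(\<forall>L. is_line L \<longrightarrow> is_singleton (f ` L) \<or> is_line (f ` L)) \<and>
    (\<forall>L. is_line L \<longrightarrow> is_line (f ` L) \<longrightarrow> inj_on f L)" by blast
next
  assume "(\<forall>L. is_line L \<longrightarrow> is_singleton (f ` L) \<or> is_line (f ` L)) \<and>
    (\<forall>L. is_line L \<longrightarrow> is_line (f ` L) \<longrightarrow> inj_on f L)"
  then have P: "preserves_lines f" by (intro preserves_linesI) blast+
  obtain a0 a1 where ex: "lin_indep_pair (f a0) (f a1)" using assms(2) by blast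
  show "linear f"
    using additive[OF P assms(1) ex] homogeneous[OF P assms(1) ex] by (rule linearI)
qed

end
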